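(* Let $F$ be a graph, let $p\ge 2$ and $m$ be positive integers. (1) Suppose that for every $n\ge m$, $S_{n,p}$ is (up to isomorphism) the unique $F$-free graph of order $n$ with $\mathrm{ex}(n,F)$ edges, i.e. $\mathrm{Ex}(n,F)=\{S_{n,p}\}$. Then for every $n\ge \max\{2^{4p},m^2\}$, $S_{n,p}$ is the unique $F$-free graph of order $n$ with maximum spectral radius, i.e. $\mathrm{Ex}_{sp}(n,F)=\{S_{n,p}\}$. (2) Suppose that for every $n\ge m$, $\mathrm{Ex}(n,F)=\{S^{+}_{n,p}\}$. Then for every $n\ge \max\{2^{4p},m^2\}$, $\mathrm{Ex}_{sp}(n,F)=\{S^{+}_{n,p}\}$.
   Context: All graphs are finite, simple, undirected. The spectral radius $\rho(G)$ is the largest eigenvalue of the adjacency matrix of $G$. A graph is $F$-free if it contains no subgraph isomorphic to $F$. $\mathrm{ex}(n,F)$ is the maximum number of edges of an $F$-free graph of order $n$, and $\mathrm{Ex}(n,F)$ is the set of $F$-free graphs of order $n$ with $\mathrm{ex}(n,F)$ edges. $\mathrm{Ex}_{sp}(n,F)$ is the set of $F$-free graphs of order $n$ having maximum spectral radius among all $F$-free graphs of order $n$. $S_{n,h}=K_h\vee \overline{K}_{n-h}$ (a clique of order $h$ joined to every vertex of an independent set of order $n-h$), and $S^{+}_{n,h}=K_h\vee(K_2\cup\overline{K}_{n-h-2})$ is $S_{n,h}$ with one edge added inside the independent set. $G\vee H$ denotes the join and $G\cup H$ the vertex-disjoint union. *)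

theory Defs
  imports "Jordan_Normal_Form.Char_Poly"
begin

definition sgraph :: "'a set \<Rightarrow> 'a set set \<Rightarrow> bool" where
  "sgraph V E \<longleftrightarrow> finite V \<and> (\<forall>e\<in>E. e \<subseteq> V \<and> card e = 2)"

definition graph_on :: "nat \<Rightarrow> nat set set \<Rightarrow> bool" where
  "graph_on n E \<longleftrightarrow> sgraph {0..<n} E"

definition contains :: "nat \<Rightarrow> nat set set \<Rightarrow> 'b set \<Rightarrow> 'b set set \<Rightarrow> bool" where
  "contains n E VF EF \<longleftrightarrow>
     (\<exists>f. inj_on f VF \<and> f ` VF \<subseteq> {0..<n} \<and> (\<forall>e\<in>EF. f ` e \<in> E))"

definition F_free :: "nat \<Rightarrow> nat set set \<Rightarrow> 'b set \<Rightarrow> 'b set set \<Rightarrow> bool" where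
  "F_free n E VF EF \<longleftrightarrow> \<not> contains n E VF EF"

definition graph_iso :: "nat \<Rightarrow> nat set set \<Rightarrow> nat set set \<Rightarrow> bool" where
  "graph_iso n E E' \<longleftrightarrow>
     (\<exists>f. bij_betw f {0..<n} {0..<n} \<and>
          (\<forall>u\<in>{0..<n}. \<forall>v\<in>{0..<n}. {u, v} \<in> E \<longleftrightarrow> {f u, f v} \<in> E'))"

definition adj_mat :: "nat \<Rightarrow> nat set set \<Rightarrow> real mat" where
  "adj_mat n E = mat n n (\<lambda>(i, j). if {i, j} \<in> E then 1 else 0)"

definition spec_rad :: "nat \<Rightarrow> nat set set \<Rightarrow> real" where
  "spec_rad n E = Max {k. eigenvalue (adj_mat n E) k}"

definition Ex :: "nat \<Rightarrow> 'b set \<Rightarrow> 'b set set \<Rightarrow> nat set set set" where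
  "Ex n VF EF = {E. graph_on n E \<and> F_free n E VF EF \<and>
     (\<forall>E'. graph_on n E' \<and> F_free n E' VF EF \<longrightarrow> card E' \<le> card E)}"

definition Ex_sp :: "nat \<Rightarrow> 'b set \<Rightarrow> 'b set set \<Rightarrow> nat set set set" where
  "Ex_sp n VF EF = {E. graph_on n E \<and> F_free n E VF EF \<and>
     (\<forall>E'. graph_on n E' \<and> F_free n E' VF EF \<longrightarrow> spec_rad n E' \<le> spec_rad n E)}"

(* S_{n,h} = K_h join complement of K_{n-h}: vertices 0..<h form the clique. *)
definition S_graph :: "nat \<Rightarrow> nat \<Rightarrow> nat set set" where
  "S_graph n h = {{i, j} | i j. i < n \<and> j < n \<and> i \<noteq> j \<and> (i < h \<or> j < h)}"

definition S_plus :: "nat \<Rightarrow> nat \<Rightarrow> nat set set" where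
  "S_plus n h = insert {h, h + 1} (S_graph n h)"

(* "Ex(n,F) = {H}" up to isomorphism: the members are exactly the copies of H. *)
definition unique_up_to_iso :: "nat \<Rightarrow> nat set set set \<Rightarrow> nat set set \<Rightarrow> bool" where
  "unique_up_to_iso n X H \<longleftrightarrow> (\<forall>E. graph_on n E \<longrightarrow> (E \<in> X \<longleftrightarrow> graph_iso n E H))"

end

theory Submission
  imports Defs "HOL-Analysis.Function_Topology"
begin

text \<open>
  Let \<open>y\<close> be a nonnegative eigenvector of \<open>G\<close> for its spectral radius \<open>r\<close>, with coordinate sum \<open>Y\<close>.
  The Hong--Shu--Fang computation is the identity
  \<open>Y (r\<^sup>2 - (p - 1) r) = Y (2 e(G) - p (n - 1)) - (\<Sum>w. (d(w) - p) (Y - (1 + r) y\<^sub>w))\<close>,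
  in which \<open>Y - (1 + r) y\<^sub>w\<close>, the weight of the non-neighbours of \<open>w\<close>, lies between \<open>0\<close> and \<open>Y\<close>.
  Hence a vertex of degree \<open>d < p\<close> costs at most \<open>p - d\<close>; but deleting such vertices and applying the
  edge bound to the rest shows that it also lowers \<open>2 e(G)\<close> by \<open>2 (p - d)\<close> below the extremal value.
  As long as at least \<open>m\<close> vertices remain this gives \<open>r\<^sup>2 - (p - 1) r \<le> p (n - p)\<close>, the equation
  satisfied by \<open>r(S\<^sub>n\<^sub>,\<^sub>p)\<close>; if nearly all vertices are deficient, only \<open>n - m\<close> of them are deleted and
  the gain still wins because \<open>n\<close> is large.  For \<open>S\<^sup>+\<^sub>n\<^sub>,\<^sub>p\<close> the extra edge leaves one tight case, a single
  vertex of degree \<open>p - 1\<close> attached to \<open>S\<^sup>+\<^sub>n\<^sub>-\<^sub>1\<^sub>,\<^sub>p\<close>, which is handled by the same identity.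
\<close>

section \<open>The spectral radius as a maximum of the quadratic form\<close>

definition adj :: "nat set set \<Rightarrow> nat \<Rightarrow> nat \<Rightarrow> real" where
  "adj E u v = (if {u, v} \<in> E then 1 else 0)"

definition eigenpair :: "nat \<Rightarrow> nat set set \<Rightarrow> real \<Rightarrow> (nat \<Rightarrow> real) \<Rightarrow> bool" where
  "eigenpair n E k y \<longleftrightarrow> (\<forall>v<n. (\<Sum>u=0..<n. adj E v u * y u) = k * y v)"

definition quad_form :: "nat \<Rightarrow> nat set set \<Rightarrow> (nat \<Rightarrow> real) \<Rightarrow> real" where
  "quad_form n E x = (\<Sum>i=0..<n. \<Sum>j=0..<n. adj E i j * x i * x j)"

lemma adj_commute: "adj E u v = adj E v u"
  by (simp add: adj_def insert_commute)

lemma adj_nonneg: "adj E u v \<ge> 0"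
  by (simp add: adj_def)

lemma eigenvalue_adj_mat_iff:
  "eigenvalue (adj_mat n E) k \<longleftrightarrow> (\<exists>y. eigenpair n E k y \<and> (\<exists>i<n. y i \<noteq> 0))"
proof -
  have mv: "(adj_mat n E *\<^sub>v w) $ v = (\<Sum>u=0..<n. adj E v u * w $ u)"
    if "w \<in> carrier_vec n" "v < n" for w v
    using that by (auto simp: adj_mat_def adj_def scalar_prod_def intro!: sum.cong)
  have dims: "dim_row (adj_mat n E) = n" "dim_col (adj_mat n E) = n"
    by (auto simp: adj_mat_def)
  show ?thesis
  proof
    assume "eigenvalue (adj_mat n E) k"
    then obtain w where w: "w \<in> carrier_vec n" "w \<noteq> 0\<^sub>v n" "adj_mat n E *\<^sub>v w = k \<cdot>\<^sub>v w"
      by (auto simp: eigenvalue_def eigenvector_def dims)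
    have "eigenpair n E k (($) w)"
      unfolding eigenpair_def using mv[OF w(1)] w by auto
    moreover have "\<exists>i<n. w $ i \<noteq> 0"
      using w(1,2) by (metis carrier_vecD eq_vecI index_zero_vec)
    ultimately show "\<exists>y. eigenpair n E k y \<and> (\<exists>i<n. y i \<noteq> 0)" by blast
  next
    assume "\<exists>y. eigenpair n E k y \<and> (\<exists>i<n. y i \<noteq> 0)"
    then obtain y i where y: "eigenpair n E k y" "i < n" "y i \<noteq> 0" by blast
    define w where "w = vec n y"
    have w: "w \<in> carrier_vec n" by (simp add: w_def)
    have "adj_mat n E *\<^sub>v w = k \<cdot>\<^sub>v w"
    proof (rule eq_vecI)
      fix v assume "v < dim_vec (k \<cdot>\<^sub>v w)"
      then have v: "v < n" by (simp add: w_def)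
      then show "(adj_mat n E *\<^sub>v w) $ v = (k \<cdot>\<^sub>v w) $ v"
        using mv[OF w v] y(1) by (simp add: w_def eigenpair_def)
    qed (simp add: w_def dims)
    moreover have "w \<noteq> 0\<^sub>v n" using y(2,3) by (metis index_vec index_zero_vec(1) w_def)
    ultimately show "eigenvalue (adj_mat n E) k"
      using w by (auto simp: eigenvalue_def eigenvector_def dims)
  qed
qed

text \<open>A continuous function attains its maximum on the compact unit sphere. Vectors are
  functions on all of \<open>nat\<close>, so compactness is obtained in the product
  topology.\<close>

lemma quad_form_maximizer_exists:
  assumes "n > 0"
  shows "\<exists>x. (\<Sum>i=0..<n. (x i)\<^sup>2) = 1 \<and>
    (\<forall>z. (\<Sum>i=0..<n. (z i)\<^sup>2) = 1 \<longrightarrow> quad_form n E z \<le> quad_form n E x)"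
proof -
  \<comment> \<open>Coordinates from \<open>n\<close> on are pinned to 0; left free, they would
    destroy compactness.\<close>
  define B :: "(nat \<Rightarrow> real) set" where "B = PiE UNIV (\<lambda>i. if i < n then {-1..1} else {0})"
  define S where "S = B \<inter> {x. (\<Sum>i=0..<n. (x i)\<^sup>2) = 1}"
  have B: "compact B"
  proof -
    have "compactin (product_topology (\<lambda>i. euclidean) UNIV) B"
      unfolding B_def compactin_PiE by auto
    then show ?thesis
      by (simp add: euclidean_product_topology)
  qed
  have coord: "continuous_on A (\<lambda>x::nat \<Rightarrow> real. x i)" for A i
    by (rule continuous_on_subset[OF continuous_on_product_coordinates]) auto
  have "closed {x::nat \<Rightarrow> real. (\<Sum>i=0..<n. (x i)\<^sup>2) = 1}"
    by (intro closed_Collect_eq continuous_intros coord)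
  then have S: "compact S" unfolding S_def by (rule compact_Int_closed[OF B])
  have "(\<lambda>i. if i = 0 then 1 else 0) \<in> S"
    using assms by (auto simp: S_def B_def if_distrib[of "\<lambda>x. x\<^sup>2"] sum.delta cong: if_cong)
  then have "S \<noteq> {}" by blast
  moreover have "continuous_on S (quad_form n E)"
    unfolding quad_form_def by (intro continuous_intros coord)
  ultimately obtain x where x: "x \<in> S" "\<And>z. z \<in> S \<Longrightarrow> quad_form n E z \<le> quad_form n E x"
    using continuous_attains_sup[OF S] by blast
  have "quad_form n E z \<le> quad_form n E x" if z: "(\<Sum>i=0..<n. (z i)\<^sup>2) = 1" for z
  proof -
    \<comment> \<open>Truncation moves \<open>z\<close> into \<open>S\<close> without changing the
      form, which ignores coordinates from \<open>n\<close> on.\<close>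
    define z' where "z' i = (if i < n then z i else 0)" for i
    have eq: "quad_form n E z = quad_form n E z'"
      unfolding quad_form_def z'_def by (intro sum.cong) auto
    have "\<bar>z i\<bar> \<le> 1" if "i < n" for i
    proof -
      have "(z i)\<^sup>2 \<le> (\<Sum>i=0..<n. (z i)\<^sup>2)"
        using that by (intro member_le_sum) auto
      then show ?thesis using z by (simp add: abs_square_le_1)
    qed
    then have "z' \<in> B" by (auto simp: B_def z'_def abs_le_iff)
    moreover have "(\<Sum>i=0..<n. (z' i)\<^sup>2) = 1"
      unfolding z[symmetric] by (intro sum.cong) (auto simp: z'_def)
    ultimately have "z' \<in> S" by (simp add: S_def)
    then show ?thesis using x(2) eq by simp
  qed
  then show ?thesis using x(1) by (auto simp: S_def)
qed

lemma quad_form_eigenpair: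
  assumes "eigenpair n E k y"
  shows "quad_form n E y = k * (\<Sum>i=0..<n. (y i)\<^sup>2)"
proof -
  have "quad_form n E y = (\<Sum>i=0..<n. y i * (\<Sum>j=0..<n. adj E i j * y j))"
    unfolding quad_form_def by (simp add: sum_distrib_left mult_ac)
  also have "\<dots> = (\<Sum>i=0..<n. k * (y i)\<^sup>2)"
    using assms by (intro sum.cong) (auto simp: eigenpair_def power2_eq_square)
  finally show ?thesis by (simp add: sum_distrib_left)
qed

text \<open>Both sides are homogeneous of degree two, so a bound on the unit sphere extends to every
  vector by scaling.\<close>

lemma quad_form_le:
  assumes "\<And>z. (\<Sum>i=0..<n. (z i)\<^sup>2) = 1 \<Longrightarrow> quad_form n E z \<le> k"
  shows "quad_form n E x \<le> k * (\<Sum>i=0..<n. (x i)\<^sup>2)"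
proof (cases "(\<Sum>i=0..<n. (x i)\<^sup>2) = 0")
  case True
  then have "x i = 0" if "i < n" for i
    using that by (simp add: sum_nonneg_eq_0_iff)
  then have "quad_form n E x = 0" by (simp add: quad_form_def)
  then show ?thesis using True by simp
next
  case False
  define s where "s = sqrt (\<Sum>i=0..<n. (x i)\<^sup>2)"
  have s2: "s\<^sup>2 = (\<Sum>i=0..<n. (x i)\<^sup>2)" by (simp add: s_def sum_nonneg)
  have s0: "s \<noteq> 0" using False by (simp add: s_def)
  have "(\<Sum>i=0..<n. (x i / s)\<^sup>2) = 1"
    using s0 by (simp add: power_divide flip: sum_divide_distrib s2)
  then have "quad_form n E (\<lambda>i. x i / s) \<le> k" by (rule assms)
  moreover have "quad_form n E (\<lambda>i. x i / s) = quad_form n E x / s\<^sup>2"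
    unfolding quad_form_def by (simp add: sum_divide_distrib power2_eq_square)
  ultimately have "quad_form n E x / s\<^sup>2 \<le> k" by simp
  then show ?thesis using s0 by (simp add: field_simps flip: s2)
qed

text \<open>Near 0 a nonzero linear term outweighs any quadratic one. This serves as the first-order
  condition at a maximizer, replacing differentiation.\<close>

lemma linear_le_quadratic_imp_zero:
  fixes c k :: real
  assumes "\<And>t. t * c \<le> t\<^sup>2 * k"
  shows "c = 0"
proof (rule ccontr)
  assume "c \<noteq> 0"
  \<comment> \<open>\<open>K\<close> is positive and strictly above \<open>k\<close>, so that
    \<open>t = c / K\<close> contradicts the assumption.\<close>
  define K where "K = \<bar>k\<bar> + 1"
  have K: "K > 0" "k < K" by (auto simp: K_def)
  have "(c / K) * c \<le> (c / K)\<^sup>2 * k" by (rule assms)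
  also have "\<dots> < (c / K)\<^sup>2 * K" using K \<open>c \<noteq> 0\<close> by (intro mult_strict_left_mono) auto
  also have "\<dots> = (c / K) * c" using K by (simp add: power2_eq_square)
  finally show False by simp
qed

lemma quad_form_add_unit:
  assumes "i < n"
  shows "quad_form n E (\<lambda>j. x j + (if j = i then t else 0)) =
    quad_form n E x + 2 * t * (\<Sum>j=0..<n. adj E i j * x j) + t\<^sup>2 * adj E i i"
proof -
  let ?d = "\<lambda>j. if j = i then t else 0"
  have "quad_form n E (\<lambda>j. x j + ?d j) = quad_form n E x
      + (\<Sum>a=0..<n. \<Sum>b=0..<n. adj E a b * ?d a * x b)
      + (\<Sum>a=0..<n. \<Sum>b=0..<n. adj E a b * x a * ?d b)
      + (\<Sum>a=0..<n. \<Sum>b=0..<n. adj E a b * ?d a * ?d b)"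
    unfolding quad_form_def by (simp only: sum.distrib[symmetric]) (simp add: algebra_simps)
  also have "(\<Sum>a=0..<n. \<Sum>b=0..<n. adj E a b * ?d a * x b) = (\<Sum>a=0..<n. if a = i then t * (\<Sum>b=0..<n. adj E i b * x b) else 0)"
    by (intro sum.cong) (auto simp: sum_distrib_left mult_ac)
  also have "\<dots> = t * (\<Sum>b=0..<n. adj E i b * x b)" using assms by (simp add: sum.delta)
  also have "(\<Sum>a=0..<n. \<Sum>b=0..<n. adj E a b * x a * ?d b)
      = (\<Sum>a=0..<n. \<Sum>b=0..<n. if b = i then t * (adj E i a * x a) else 0)"
    by (intro sum.cong) (auto simp: adj_commute)
  also have "\<dots> = t * (\<Sum>a=0..<n. adj E i a * x a)"
    using assms by (simp add: sum.delta sum_distrib_left)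
  also have "(\<Sum>a=0..<n. \<Sum>b=0..<n. adj E a b * ?d a * ?d b)
      = (\<Sum>a=0..<n. \<Sum>b=0..<n. if b = i then if a = i then t\<^sup>2 * adj E i i else 0 else 0)"
    by (intro sum.cong) (auto simp: power2_eq_square)
  also have "\<dots> = t\<^sup>2 * adj E i i" using assms by (simp add: sum.delta)
  finally show ?thesis by simp
qed

lemma sum_squares_add_unit:
  fixes x :: "nat \<Rightarrow> real"
  assumes "i < n"
  shows "(\<Sum>j=0..<n. (x j + (if j = i then t else 0))\<^sup>2) = (\<Sum>j=0..<n. (x j)\<^sup>2) + 2 * t * x i + t\<^sup>2"
proof -
  have "(\<Sum>j=0..<n. (x j + (if j = i then t else 0))\<^sup>2)
      = (\<Sum>j=0..<n. (x j)\<^sup>2 + (if j = i then 2 * t * x i + t\<^sup>2 else 0))"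
    by (intro sum.cong) (auto simp: power2_sum)
  then show ?thesis using assms by (simp add: sum.distrib sum.delta)
qed

text \<open>Taking absolute values of a maximizer does not lower the form, because adjacency entries
  are nonnegative. The result is again a maximizer, hence a nonnegative eigenvector for the maximum
  of the form, and that maximum bounds every eigenvalue.\<close>

lemma spec_rad_Perron:
  assumes "n > 0"
  obtains y where "eigenpair n E (spec_rad n E) y" "\<And>i. y i \<ge> 0" "(\<Sum>i=0..<n. y i) > 0"
    "\<And>x. quad_form n E x \<le> spec_rad n E * (\<Sum>i=0..<n. (x i)\<^sup>2)"
    "\<And>k. eigenvalue (adj_mat n E) k \<Longrightarrow> k \<le> spec_rad n E"
proof -
  obtain x where x: "(\<Sum>i=0..<n. (x i)\<^sup>2) = 1"
    and xmax: "\<And>z. (\<Sum>i=0..<n. (z i)\<^sup>2) = 1 \<Longrightarrow> quad_form n E z \<le> quad_form n E x"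
    using quad_form_maximizer_exists[OF assms] by blast
  define k where "k = quad_form n E x"
  define y where "y i = \<bar>x i\<bar>" for i
  have le: "quad_form n E z \<le> k * (\<Sum>i=0..<n. (z i)\<^sup>2)" for z
    by (rule quad_form_le) (use xmax k_def in auto)
  have y1: "(\<Sum>i=0..<n. (y i)\<^sup>2) = 1" using x by (simp add: y_def)
  have "adj E i j * x i * x j \<le> adj E i j * y i * y j" for i j
    by (rule order_trans[OF abs_ge_self]) (simp add: abs_mult adj_def y_def)
  then have "k \<le> quad_form n E y"
    unfolding k_def quad_form_def by (intro sum_mono)
  then have yk: "quad_form n E y = k" using xmax[OF y1] k_def by simp
  have ep: "eigenpair n E k y" unfolding eigenpair_def
  proof (intro allI impI)
    fix i assume i: "i < n"
    let ?c = "2 * ((\<Sum>j=0..<n. adj E i j * y j) - k * y i)"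
    \<comment> \<open>Maximality is tested after adding \<open>t\<close> to coordinate
      \<open>i\<close>; the constant terms cancel because \<open>y\<close> has norm 1 and form value
      \<open>k\<close>.\<close>
    have "t * ?c \<le> t\<^sup>2 * (k - adj E i i)" for t
      using le[of "\<lambda>j. y j + (if j = i then t else 0)"]
      unfolding quad_form_add_unit[OF i] sum_squares_add_unit[OF i] y1 yk
      by (simp add: algebra_simps)
    from linear_le_quadratic_imp_zero[OF this]
    show "(\<Sum>j=0..<n. adj E i j * y j) = k * y i" by simp
  qed
  have ev_le: "l \<le> k" if l: "eigenvalue (adj_mat n E) l" for l
  proof -
    obtain z i where z: "eigenpair n E l z" "i < n" "z i \<noteq> 0"
      using l unfolding eigenvalue_adj_mat_iff by blast
    have "(\<Sum>i=0..<n. (z i)\<^sup>2) > 0" using z(2,3) by (intro sum_pos2[of _ i]) auto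
    moreover have "l * (\<Sum>i=0..<n. (z i)\<^sup>2) \<le> k * (\<Sum>i=0..<n. (z i)\<^sup>2)"
      using le[of z] quad_form_eigenpair[OF z(1)] by simp
    ultimately show ?thesis by simp
  qed
  have "\<exists>i<n. y i \<noteq> 0"
  proof (rule ccontr)
    assume "\<not> ?thesis"
    then have "(\<Sum>i=0..<n. (y i)\<^sup>2) = 0" by simp
    then show False using y1 by simp
  qed
  then obtain i where i: "i < n" "y i \<noteq> 0" by blast
  then have ev: "eigenvalue (adj_mat n E) k" using ep eigenvalue_adj_mat_iff by blast
  have A: "adj_mat n E \<in> carrier_mat n n" by (simp add: adj_mat_def)
  \<comment> \<open>Finiteness of the spectrum makes the \<open>Max\<close> in
    \<open>spec_rad\<close> meaningful.\<close>
  have "char_poly (adj_mat n E) \<noteq> 0" using degree_monic_char_poly[OF A] by auto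
  then have "finite {k. eigenvalue (adj_mat n E) k}"
    unfolding eigenvalue_root_char_poly[OF A] by (rule poly_roots_finite)
  then have k: "spec_rad n E = k"
    unfolding spec_rad_def using ev ev_le by (intro Max_eqI) auto
  show thesis
  proof
    show "(\<Sum>i=0..<n. y i) > 0" using i by (intro sum_pos2[of _ i]) (auto simp: y_def)
    show "y i \<ge> 0" for i by (simp add: y_def)
  qed (use ep le ev_le k in auto)
qed

section \<open>A degree-sensitive Hong--Shu--Fang bound\<close>

definition deg :: "nat set set \<Rightarrow> nat \<Rightarrow> nat" where
  "deg E v = card {e \<in> E. v \<in> e}"

definition deficient :: "nat \<Rightarrow> nat set set \<Rightarrow> nat \<Rightarrow> nat set" where
  "deficient n E p = {v. v < n \<and> deg E v < p}"

lemma graph_on_finite: "graph_on n E \<Longrightarrow> finite E"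
  unfolding graph_on_def sgraph_def by (meson PowI finite_Pow_iff finite_subset subsetI)

lemma adj_self: "graph_on n E \<Longrightarrow> adj E v v = 0"
  by (auto simp: graph_on_def sgraph_def adj_def)

lemma edge_ends:
  assumes "graph_on n E" "e \<in> E" "v \<in> e"
  obtains u where "e = {v, u}" "u < n" "v < n" "u \<noteq> v"
proof -
  have e: "e \<subseteq> {0..<n}" "card e = 2" using assms by (auto simp: graph_on_def sgraph_def)
  then obtain a b where "e = {a, b}" "a \<noteq> b" by (auto simp: card_2_iff)
  then show thesis using assms(3) e(1) that[of a] that[of b] by auto
qed

lemma sum_adj_eq_deg:
  assumes "graph_on n E" "v < n"
  shows "(\<Sum>u=0..<n. adj E v u) = real (deg E v)"
proof -
  have "bij_betw (\<lambda>u. {v, u}) {u \<in> {0..<n}. {v, u} \<in> E} {e \<in> E. v \<in> e}"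
    unfolding bij_betw_def
  proof
    show "inj_on (\<lambda>u. {v, u}) {u \<in> {0..<n}. {v, u} \<in> E}"
      by (auto simp: inj_on_def doubleton_eq_iff)
    show "(\<lambda>u. {v, u}) ` {u \<in> {0..<n}. {v, u} \<in> E} = {e \<in> E. v \<in> e}"
      using assms by (auto elim!: edge_ends)
  qed
  then have "deg E v = card {u \<in> {0..<n}. {v, u} \<in> E}"
    unfolding deg_def by (simp add: bij_betw_same_card)
  then show ?thesis by (simp add: adj_def flip: sum.inter_filter)
qed

lemma handshake:
  assumes "graph_on n E"
  shows "(\<Sum>v=0..<n. deg E v) = 2 * card E"
  unfolding deg_def
proof (rule sum_multicount)
  show "\<forall>e\<in>E. card {v \<in> {0..<n}. v \<in> e} = 2"
  proof
    fix e assume "e \<in> E"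
    then have "e \<subseteq> {0..<n}" "card e = 2"
      using assms by (auto simp: graph_on_def sgraph_def)
    moreover from this have "{v \<in> {0..<n}. v \<in> e} = e" by blast
    ultimately show "card {v \<in> {0..<n}. v \<in> e} = 2" by simp
  qed
qed (use graph_on_finite[OF assms] in auto)

text \<open>An edge either avoids \<open>D\<close> or is counted at an end in \<open>D\<close>.
  Edges with both ends in \<open>D\<close> are counted twice, hence only an inequality.\<close>

lemma card_edges_le_remove:
  assumes "graph_on n E" "D \<subseteq> {0..<n}"
  shows "card E \<le> card {e \<in> E. e \<subseteq> {0..<n} - D} + (\<Sum>v\<in>D. deg E v)"
proof -
  have D: "finite D" using assms(2) finite_subset by blast
  have "E \<subseteq> {e \<in> E. e \<subseteq> {0..<n} - D} \<union> (\<Union>v\<in>D. {e \<in> E. v \<in> e})"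
    using assms(1) by (auto simp: graph_on_def sgraph_def)
  then have "card E \<le> card ({e \<in> E. e \<subseteq> {0..<n} - D} \<union> (\<Union>v\<in>D. {e \<in> E. v \<in> e}))"
    using graph_on_finite[OF assms(1)] D by (intro card_mono) auto
  also have "\<dots> \<le> card {e \<in> E. e \<subseteq> {0..<n} - D} + card (\<Union>v\<in>D. {e \<in> E. v \<in> e})"
    by (rule card_Un_le)
  also have "card (\<Union>v\<in>D. {e \<in> E. v \<in> e}) \<le> (\<Sum>v\<in>D. deg E v)"
    unfolding deg_def by (rule card_UN_le[OF D])
  finally show ?thesis by simp
qed

text \<open>These are the facts that the counting takes from the Perron eigenvector. The sum
  \<open>Y\<close> is kept as a scale factor instead of normalising \<open>y\<close>.\<close>

locale nonneg_eigenpair =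
  fixes n :: nat and E :: "nat set set" and r :: real and y :: "nat \<Rightarrow> real" and Y :: real
  assumes graph: "graph_on n E" and eigen: "eigenpair n E r y"
    and nonneg: "\<And>i. y i \<ge> 0" and Y_def: "Y = (\<Sum>i=0..<n. y i)" and Y_pos: "Y > 0"
begin

lemma eigen_eq: "v < n \<Longrightarrow> (\<Sum>u=0..<n. adj E v u * y u) = r * y v"
  using eigen by (simp add: eigenpair_def)

text \<open>Adding up the eigenvalue equations of all vertices counts each \<open>y u\<close> once
  per neighbour of \<open>u\<close>.\<close>

lemma sum_deg_weighted: "(\<Sum>v=0..<n. real (deg E v) * y v) = r * Y"
proof -
  have "r * Y = (\<Sum>v=0..<n. \<Sum>u=0..<n. adj E v u * y u)"
    by (simp add: Y_def sum_distrib_left eigen_eq)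
  also have "\<dots> = (\<Sum>u=0..<n. (\<Sum>v=0..<n. adj E u v) * y u)"
    by (subst sum.swap) (simp add: sum_distrib_right adj_commute)
  also have "\<dots> = (\<Sum>u=0..<n. real (deg E u) * y u)"
    using graph by (simp add: sum_adj_eq_deg)
  finally show ?thesis by simp
qed

text \<open>The weight \<open>Y - (1 + r) * y w\<close> is the sum of \<open>y\<close> over the non-neighbours of \<open>w\<close>.\<close>

lemma non_neighbour_weight:
  assumes "w < n"
  shows "0 \<le> Y - (1 + r) * y w" "Y - (1 + r) * y w \<le> Y"
proof -
  have eq: "(1 + r) * y w = y w + (\<Sum>u=0..<n. adj E w u * y u)"
    using eigen_eq[OF assms] by (simp add: algebra_simps)
  have "y w = (\<Sum>u=0..<n. if u = w then y u else 0)" using assms by simp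
  then have "(1 + r) * y w = (\<Sum>u=0..<n. (if u = w then y u else 0) + adj E w u * y u)"
    unfolding eq by (simp add: sum.distrib)
  also have "\<dots> \<le> Y" unfolding Y_def
    using adj_self[OF graph] nonneg by (intro sum_mono) (auto simp: adj_def)
  finally show "0 \<le> Y - (1 + r) * y w" by simp
  have "0 \<le> (1 + r) * y w"
    unfolding eq using nonneg adj_nonneg by (intro add_nonneg_nonneg sum_nonneg mult_nonneg_nonneg) auto
  then show "Y - (1 + r) * y w \<le> Y" by simp
qed

text \<open>After expansion only three sums occur: the degrees give twice the edge number, the
  weighted degrees give \<open>r * Y\<close>, and the coordinates give \<open>Y\<close>.\<close>

lemma excess_identity:
  "Y * (r\<^sup>2 - (c - 1) * r) =
    Y * (2 * real (card E) - c * (real n - 1)) - (\<Sum>w=0..<n. (real (deg E w) - c) * (Y - (1 + r) * y w))"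
proof -
  have "real (\<Sum>w=0..<n. deg E w) = 2 * real (card E)"
    using handshake[OF graph] by simp
  then have e: "(\<Sum>w=0..<n. real (deg E w)) = 2 * real (card E)" by simp
  have "(\<Sum>w=0..<n. (real (deg E w) - c) * (Y - (1 + r) * y w))
    = (\<Sum>w=0..<n. Y * real (deg E w) - c * Y - (1 + r) * (real (deg E w) * y w) + (1 + r) * c * y w)"
    by (intro sum.cong) (auto simp: algebra_simps)
  also have "\<dots> = Y * (2 * real (card E)) - real n * (c * Y) - (1 + r) * (r * Y) + (1 + r) * c * Y"
    unfolding sum.distrib sum_subtractf sum_distrib_left[symmetric] e sum_deg_weighted
    by (simp add: Y_def)
  finally show ?thesis by (simp add: algebra_simps power2_eq_square)
qed

lemma excess_le:
  assumes "r\<^sup>2 - (c - 1) * r > X"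
  shows "(\<Sum>w=0..<n. (real (deg E w) - c) * (Y - (1 + r) * y w))
    < Y * (2 * real (card E) - c * (real n - 1) - X)"
proof -
  have "Y * X < Y * (r\<^sup>2 - (c - 1) * r)" using assms Y_pos by simp
  then show ?thesis unfolding excess_identity by (simp add: algebra_simps)
qed

text \<open>In the excess sum a vertex of degree at least \<open>p\<close> contributes a nonnegative
  term, and a deficient one at least \<open>(deg E v - p) * Y\<close>, since its non-neighbour
  weight is at most \<open>Y\<close>.\<close>

lemma Hong_Shu_Fang_deficient:
  "r\<^sup>2 - (real p - 1) * r \<le> 2 * real (card E) - real p * (real n - 1)
    + (\<Sum>v\<in>deficient n E p. real p - real (deg E v))"
proof (rule ccontr)
  let ?D = "deficient n E p"
  let ?f = "\<lambda>w. (real (deg E w) - real p) * (Y - (1 + r) * y w)"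
  assume "\<not> ?thesis"
  then have "(\<Sum>w=0..<n. ?f w) < Y * (- (\<Sum>v\<in>?D. real p - real (deg E v)))"
    using excess_le[where c = "real p" and X = "2 * real (card E) - real p * (real n - 1)
      + (\<Sum>v\<in>?D. real p - real (deg E v))"] by (simp add: not_le)
  moreover have "Y * (- (\<Sum>v\<in>?D. real p - real (deg E v))) = (\<Sum>v\<in>?D. (real (deg E v) - real p) * Y)"
    by (simp add: sum_distrib_left sum_negf[symmetric] algebra_simps)
  moreover have "\<dots> \<le> (\<Sum>v\<in>?D. ?f v)"
    using non_neighbour_weight by (intro sum_mono mult_left_mono_neg) (auto simp: deficient_def)
  moreover have "\<dots> \<le> (\<Sum>w=0..<n. ?f w)"
    using non_neighbour_weight
    by (intro sum_mono2) (auto simp: deficient_def intro!: mult_nonneg_nonneg)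
  ultimately show False by linarith
qed

end

section \<open>The graphs \<open>S_graph\<close> and \<open>S_plus\<close>\<close>

lemma doubleton_in_S_graph:
  "{i, j} \<in> S_graph n h \<longleftrightarrow> i < n \<and> j < n \<and> i \<noteq> j \<and> (i < h \<or> j < h)"
  unfolding S_graph_def by (auto simp: doubleton_eq_iff)

lemma doubleton_in_S_plus:
  "{i, j} \<in> S_plus n h \<longleftrightarrow> {i, j} \<in> S_graph n h \<or> i = h \<and> j = h + 1 \<or> i = h + 1 \<and> j = h"
  unfolding S_plus_def by (auto simp: doubleton_eq_iff)

lemma graph_on_S_graph: "graph_on n (S_graph n h)"
  unfolding graph_on_def sgraph_def S_graph_def by auto

lemma graph_on_S_plus: "h + 2 \<le> n \<Longrightarrow> graph_on n (S_plus n h)"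
  using graph_on_S_graph[of n h] unfolding graph_on_def sgraph_def S_plus_def by auto

text \<open>Induction starts from the clique on \<open>p\<close> vertices, and each further vertex
  brings \<open>p\<close> edges. The form avoids subtraction and halving in
  \<open>nat\<close>.\<close>

lemma card_S_graph:
  assumes "p \<le> k"
  shows "2 * card (S_graph k p) + p * (p + 1) = 2 * p * k"
  using assms
proof (induction k rule: dec_induct)
  case base
  have "S_graph p p = {e. e \<subseteq> {0..<p} \<and> card e = 2}"
    unfolding S_graph_def by (auto simp: card_2_iff) blast
  then have "card (S_graph p p) = p choose 2" by (simp add: n_subsets)
  moreover have "2 * (p choose 2) + p * (p + 1) = 2 * p * p"
    by (cases p) (auto simp: choose_two algebra_simps)
  ultimately show ?case by simp
next
  case (step k)
  let ?N = "(\<lambda>i. {i, k}) ` {..<p}"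
  have eq: "S_graph (Suc k) p = S_graph k p \<union> ?N"
  proof (intro equalityI subsetI)
    fix e assume "e \<in> S_graph (Suc k) p"
    then obtain i j where ij: "e = {i, j}" "i < Suc k" "j < Suc k" "i \<noteq> j" "i < p \<or> j < p"
      unfolding S_graph_def by blast
    then consider "i = k" "j < p" | "j = k" "i < p" | "i < k" "j < k"
      using step.hyps by linarith
    then show "e \<in> S_graph k p \<union> ?N"
      by cases (use ij in \<open>auto simp: doubleton_in_S_graph insert_commute\<close>)
  next
    fix e assume e: "e \<in> S_graph k p \<union> ?N"
    then show "e \<in> S_graph (Suc k) p"
    proof
      assume "e \<in> S_graph k p"
      then show ?thesis unfolding S_graph_def using less_SucI by blast
    next
      assume "e \<in> ?N"
      then show ?thesis using step.hyps by (auto simp: doubleton_in_S_graph)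
    qed
  qed
  have "S_graph k p \<inter> ?N = {}" by (auto simp: doubleton_in_S_graph)
  moreover have "finite (S_graph k p)" by (rule graph_on_finite[OF graph_on_S_graph])
  moreover have "card ?N = p"
    by (subst card_image) (auto simp: inj_on_def doubleton_eq_iff)
  ultimately have "card (S_graph (Suc k) p) = card (S_graph k p) + p"
    unfolding eq by (subst card_Un_disjoint) auto
  then show ?case using step.IH by (simp add: algebra_simps)
qed

lemma card_S_plus: "card (S_plus n h) = card (S_graph n h) + 1"
proof -
  have "{h, h + 1} \<notin> S_graph n h" by (simp add: doubleton_in_S_graph)
  then show ?thesis
    using graph_on_finite[OF graph_on_S_graph] by (simp add: S_plus_def)
qed

text \<open>The larger root of \<open>x^2 - (p - 1) x = p (n - p)\<close>, the characteristic
  equation of the quotient of \<open>S_graph n p\<close> by clique and independent set.\<close>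

definition S_root :: "nat \<Rightarrow> nat \<Rightarrow> real" where
  "S_root n p = (real p - 1) / 2 + sqrt (real p * (real n - real p) + ((real p - 1) / 2)\<^sup>2)"

text \<open>The eigenvector for \<open>S_root\<close>, constant on the clique and on the independent
  set.\<close>

definition S_vector :: "nat \<Rightarrow> nat \<Rightarrow> nat \<Rightarrow> real" where
  "S_vector n p i = (if i < p then S_root n p else real p)"

lemma S_root_eq:
  assumes "p \<le> n"
  shows "(S_root n p)\<^sup>2 - (real p - 1) * S_root n p = real p * (real n - real p)"
proof -
  let ?s = "sqrt (real p * (real n - real p) + ((real p - 1) / 2)\<^sup>2)"
  have "?s\<^sup>2 = real p * (real n - real p) + ((real p - 1) / 2)\<^sup>2"
    using assms by (intro real_sqrt_pow2 add_nonneg_nonneg mult_nonneg_nonneg) auto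
  then show ?thesis unfolding S_root_def by (simp add: power2_eq_square field_simps)
qed

lemma S_root_ge:
  assumes "0 < p" "p \<le> n"
  shows "real p - 1 \<le> S_root n p"
proof -
  have "(real p - 1) / 2 \<le> sqrt (real p * (real n - real p) + ((real p - 1) / 2)\<^sup>2)"
    using assms by (intro real_le_rsqrt) auto
  then show ?thesis unfolding S_root_def by argo
qed

text \<open>With \<open>t\<close> the root, the difference of the two quadratics factors as
  \<open>(r - t) (r + t - (p - 1))\<close>; for \<open>r > t\<close> both factors are
  positive.\<close>

lemma le_S_root:
  assumes "0 < p" "p \<le> n" "r\<^sup>2 - (real p - 1) * r \<le> real p * (real n - real p)"
  shows "r \<le> S_root n p"
proof (rule ccontr)
  let ?t = "S_root n p"
  assume "\<not> ?thesis"
  then have "(r - ?t) * (r + ?t - (real p - 1)) > 0"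
    using S_root_ge[OF assms(1,2)] assms(1) by (intro mult_pos_pos) auto
  then show False
    using assms(3) S_root_eq[OF assms(2)] by (simp add: algebra_simps power2_eq_square)
qed

lemma less_S_root:
  assumes "0 < p" "p \<le> n" "r\<^sup>2 - (real p - 1) * r < real p * (real n - real p)"
  shows "r < S_root n p"
  using le_S_root[OF assms(1,2), of r] S_root_eq[OF assms(2)] assms(3)
  by (cases "r = S_root n p") auto

lemma eigenpair_S_graph:
  assumes "0 < p" "p \<le> n"
  shows "eigenpair n (S_graph n p) (S_root n p) (S_vector n p)"
  unfolding eigenpair_def
proof (intro allI impI)
  fix v assume v: "v < n"
  let ?t = "S_root n p"
  have split: "(\<Sum>u=0..<n. adj (S_graph n p) v u * S_vector n p u)
    = (\<Sum>u=0..<p. adj (S_graph n p) v u * S_vector n p u)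
    + (\<Sum>u=p..<n. adj (S_graph n p) v u * S_vector n p u)"
    using assms by (simp add: sum.atLeastLessThan_concat)
  show "(\<Sum>u=0..<n. adj (S_graph n p) v u * S_vector n p u) = ?t * S_vector n p v"
  proof (cases "v < p")
    case True
    \<comment> \<open>At \<open>u = v\<close> the pair collapses to the singleton
      \<open>{v}\<close>, so this instance of the membership rule is supplied in simplified
      form.\<close>
    have "(\<Sum>u=0..<p. adj (S_graph n p) v u * S_vector n p u) = (\<Sum>u\<in>{0..<p} - {v}. ?t)"
      using True assms v
      by (intro sum.mono_neutral_cong_right) 
        (auto simp: adj_def doubleton_in_S_graph doubleton_in_S_graph[of v v, simplified] S_vector_def)
    also have "\<dots> = (real p - 1) * ?t" using True by (simp add: of_nat_diff)
    finally have 1: "(\<Sum>u=0..<p. adj (S_graph n p) v u * S_vector n p u) = (real p - 1) * ?t" .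
    have "(\<Sum>u=p..<n. adj (S_graph n p) v u * S_vector n p u) = (\<Sum>u=p..<n. real p)"
      using True v by (intro sum.cong) (auto simp: adj_def doubleton_in_S_graph S_vector_def)
    also have "\<dots> = real p * (real n - real p)" using assms by (simp add: of_nat_diff)
    finally show ?thesis
      using split 1 True S_root_eq[OF assms(2)] by (simp add: S_vector_def power2_eq_square)
  next
    case False
    have "(\<Sum>u=0..<p. adj (S_graph n p) v u * S_vector n p u) = (\<Sum>u=0..<p. ?t)"
      using False assms v by (intro sum.cong) (auto simp: adj_def doubleton_in_S_graph S_vector_def)
    moreover have "(\<Sum>u=p..<n. adj (S_graph n p) v u * S_vector n p u) = 0"
      using False by (intro sum.neutral) (auto simp: adj_def doubleton_in_S_graph)
    ultimately show ?thesis using split False by (simp add: S_vector_def)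
  qed
qed

lemma spec_rad_S_graph_ge:
  assumes "0 < p" "p < n"
  shows "S_root n p \<le> spec_rad n (S_graph n p)"
proof -
  have n: "n > 0" using assms by simp
  have "S_vector n p p \<noteq> 0" using assms by (simp add: S_vector_def)
  then have "eigenvalue (adj_mat n (S_graph n p)) (S_root n p)"
    unfolding eigenvalue_adj_mat_iff using eigenpair_S_graph[of p n] assms by fastforce
  then show ?thesis by (metis spec_rad_Perron[OF n])
qed

text \<open>The eigenvector of \<open>S_graph\<close> is used as a test vector for
  \<open>S_plus\<close>: the extra edge joins two coordinates equal to \<open>p\<close>, so the form
  strictly grows.\<close>

lemma spec_rad_S_plus_greater:
  assumes "0 < p" "p + 2 \<le> n"
  shows "S_root n p < spec_rad n (S_plus n p)"
proof -
  let ?x = "S_vector n p"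
  have n: "n > 0" using assms by simp
  have x: "?x i \<ge> 0" for i using S_root_ge[of p n] assms by (simp add: S_vector_def)
  have le: "adj (S_graph n p) i j * ?x i * ?x j \<le> adj (S_plus n p) i j * ?x i * ?x j" for i j
    using x by (intro mult_right_mono) (auto simp: adj_def S_plus_def)
  have "quad_form n (S_graph n p) ?x < quad_form n (S_plus n p) ?x"
    unfolding quad_form_def
  proof (rule sum_strict_mono_ex1)
    show "\<forall>i\<in>{0..<n}. (\<Sum>j=0..<n. adj (S_graph n p) i j * ?x i * ?x j)
        \<le> (\<Sum>j=0..<n. adj (S_plus n p) i j * ?x i * ?x j)"
      by (intro ballI sum_mono le)
    have "(\<Sum>j=0..<n. adj (S_graph n p) p j * ?x p * ?x j)
        < (\<Sum>j=0..<n. adj (S_plus n p) p j * ?x p * ?x j)"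
    proof (rule sum_strict_mono_ex1)
      show "\<exists>j\<in>{0..<n}. adj (S_graph n p) p j * ?x p * ?x j < adj (S_plus n p) p j * ?x p * ?x j"
        using assms by (intro bexI[of _ "p + 1"])
          (auto simp: adj_def doubleton_in_S_graph doubleton_in_S_plus S_vector_def)
    qed (use le in auto)
    then show "\<exists>i\<in>{0..<n}. (\<Sum>j=0..<n. adj (S_graph n p) i j * ?x i * ?x j)
        < (\<Sum>j=0..<n. adj (S_plus n p) i j * ?x i * ?x j)"
      using assms by (intro bexI[of _ p]) auto
  qed simp
  also have "\<dots> \<le> spec_rad n (S_plus n p) * (\<Sum>i=0..<n. (?x i)\<^sup>2)"
    by (metis spec_rad_Perron[OF n])
  finally have "S_root n p * (\<Sum>i=0..<n. (?x i)\<^sup>2) < spec_rad n (S_plus n p) * (\<Sum>i=0..<n. (?x i)\<^sup>2)"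
    using quad_form_eigenpair[OF eigenpair_S_graph] assms by simp
  then show ?thesis by (rule mult_right_less_imp_less) (simp add: sum_nonneg)
qed

lemma sum_adj_S_plus:
  assumes "p \<le> a" "a < k" "p + 2 \<le> k"
  shows "(\<Sum>b=0..<k. adj (S_plus k p) a b * w b) = (\<Sum>b=0..<p. w b)
    + (if a = p then w (p + 1) else 0) + (if a = p + 1 then w p else 0)"
proof -
  have "(\<Sum>b=0..<k. adj (S_plus k p) a b * w b)
    = (\<Sum>b=0..<p. adj (S_plus k p) a b * w b) + (\<Sum>b=p..<k. adj (S_plus k p) a b * w b)"
    using assms by (simp add: sum.atLeastLessThan_concat)
  also have "(\<Sum>b=0..<p. adj (S_plus k p) a b * w b) = (\<Sum>b=0..<p. w b)"
    using assms by (intro sum.cong) (auto simp: adj_def doubleton_in_S_graph doubleton_in_S_plus)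
  also have "(\<Sum>b=p..<k. adj (S_plus k p) a b * w b)
    = (\<Sum>b=p..<k. (if b = p + 1 then (if a = p then w b else 0) else 0)
        + (if b = p then (if a = p + 1 then w b else 0) else 0))"
    using assms by (intro sum.cong) (auto simp: adj_def doubleton_in_S_graph doubleton_in_S_plus)
  also have "\<dots> = (if a = p then w (p + 1) else 0) + (if a = p + 1 then w p else 0)"
    using assms by (simp add: sum.distrib)
  finally show ?thesis by simp
qed

text \<open>
  This is the one configuration in which a deficient vertex \<open>u\<close> cannot be paid for by counting
  edges; the excess of the two ends of the extra edge compensates for the deficiency of \<open>u\<close>.
\<close>

lemma (in nonneg_eigenpair) excess_nonneg_S_plus_extension:
  assumes u: "u < n" "real (deg E u) = real p - 1"
    and rich: "\<And>v. v < n \<Longrightarrow> v \<noteq> u \<Longrightarrow> deg E v \<ge> p"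
    and h: "bij_betw h {0..<n - 1} ({0..<n} - {u})"
    and hE: "\<And>a b. a < n - 1 \<Longrightarrow> b < n - 1 \<Longrightarrow> {h a, h b} \<in> E \<longleftrightarrow> {a, b} \<in> S_plus (n - 1) p"
    and r: "3 \<le> r" "2 * r \<le> real n - real p - 3" and np: "p + 3 \<le> n"
  shows "0 \<le> (\<Sum>w=0..<n. (real (deg E w) - real p) * (Y - (1 + r) * y w))"
proof -
  define N where "N = n - 1"
  define z where "z a = y (h a)" for a
  define S where "S = (\<Sum>a=0..<p. z a)"
  define R where "R = (\<Sum>a=p+2..<N. z a)"
  let ?f = "\<lambda>w. (real (deg E w) - real p) * (Y - (1 + r) * y w)"
  have N: "p + 2 \<le> N" "n = N + 1" using np by (auto simp: N_def)
  have h: "bij_betw h {0..<N} ({0..<n} - {u})" using h by (simp add: N_def)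
  have h_in: "h a < n" "h a \<noteq> u" if "a < N" for a
    using bij_betwE[OF h] that by auto
  have split: "(\<Sum>w=0..<n. g w) = g u + (\<Sum>a=0..<N. g (h a))" for g :: "nat \<Rightarrow> real"
    using u(1) by (simp add: sum.remove[of "{0..<n}" u] sum.reindex_bij_betw[OF h, symmetric])
  have adj_h: "adj E (h a) (h b) = adj (S_plus N p) a b" if "a < N" "b < N" for a b
    using hE[of a b] that by (simp add: adj_def N_def)
  \<comment> \<open>The function \<open>g\<close> stays arbitrary because two instances are used:
    \<open>y\<close> for the eigenvalue equations and the constant 1 for degrees.\<close>
  have row: "(\<Sum>w=0..<n. adj E (h a) w * g w) = adj E (h a) u * g u + (\<Sum>b=0..<p. g (h b))
      + (if a = p then g (h (p + 1)) else 0) + (if a = p + 1 then g (h p) else 0)"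
    if "p \<le> a" "a < N" for a and g :: "nat \<Rightarrow> real"
  proof -
    have "(\<Sum>b=0..<N. adj E (h a) (h b) * g (h b)) = (\<Sum>b=0..<N. adj (S_plus N p) a b * g (h b))"
      using that by (intro sum.cong) (auto simp: adj_h)
    then show ?thesis
      unfolding split using sum_adj_S_plus[of p a N "\<lambda>b. g (h b)"] that N by simp
  qed
  have adj01: "0 \<le> adj E v u * y u" "adj E v u * y u \<le> y u" for v
    using nonneg by (auto simp: adj_def)
  have nn: "0 \<le> y u" "0 \<le> z a" "0 \<le> S" "0 \<le> R" for a
    unfolding z_def S_def R_def using nonneg by (auto intro: sum_nonneg)
  have zp: "r * z p \<le> S + z (p + 1) + y u"
    using eigen_eq[OF h_in(1), of p] row[of p y] N adj01[of "h p"] by (simp add: z_def S_def)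
  have zp1: "r * z (p + 1) \<le> S + z p + y u"
    using eigen_eq[OF h_in(1), of "p + 1"] row[of "p + 1" y] N adj01[of "h (p + 1)"]
    by (simp add: z_def S_def)
  have rest: "S \<le> r * z a" if "a \<in> {p+2..<N}" for a
    using eigen_eq[OF h_in(1), of a] row[of a y] that adj01[of "h a"] by (simp add: z_def S_def)
  \<comment> \<open>Each of the \<open>N - p - 2 = n - p - 3\<close> vertices off the clique and off
    the extra edge sees the whole clique. As \<open>2 * r\<close> is at most this number, their
    total weight \<open>R\<close> is at least \<open>2 * S\<close>.\<close>
  have "real (N - (p + 2)) * S \<le> r * R"
    unfolding R_def sum_distrib_left using sum_mono[OF rest, of "{p+2..<N}" "\<lambda>a. a"] by simp
  moreover have "2 * r * S \<le> real (N - (p + 2)) * S"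
    using r(2) N nn by (intro mult_right_mono) (auto simp: of_nat_diff)
  ultimately have "r * (2 * S) \<le> r * R" by simp
  then have RS: "2 * S \<le> R" using r(1) by (simp add: mult_le_cancel_left)
  have "2 * (z p + z (p + 1)) \<le> (r - 1) * (z p + z (p + 1))"
    using r(1) nn by (intro mult_right_mono) auto
  also have "\<dots> \<le> 2 * (S + y u)" using zp zp1 by (simp add: algebra_simps)
  finally have B: "z p + z (p + 1) \<le> S + y u" by simp
  have "(\<Sum>a=0..<N. z a) = S + (\<Sum>a=p..<N. z a)"
    using N by (simp add: S_def sum.atLeastLessThan_concat)
  also have "(\<Sum>a=p..<N. z a) = z p + z (p + 1) + R"
    using N by (simp add: R_def sum.atLeast_Suc_lessThan)
  finally have Y: "Y = y u + S + z p + z (p + 1) + R"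
    unfolding Y_def split by (simp add: z_def)
  have "3 * y u \<le> r * y u" using r(1) nn by (intro mult_right_mono) auto
  \<comment> \<open>This is the lower bound for the combined terms of \<open>u\<close> and the two
    ends of the extra edge: \<open>u\<close> contributes \<open>-(Y - (1 + r) * y u)\<close> and
    each end at least its own non-neighbour weight.\<close>
  then have main: "0 \<le> Y + (1 + r) * y u - (1 + r) * (z p + z (p + 1))"
    using zp zp1 B RS nn unfolding Y by (simp add: algebra_simps)
  have deg_ge: "real p + 1 \<le> real (deg E (h a))" if "a = p \<or> a = p + 1" for a
    using sum_adj_eq_deg[OF graph h_in(1), of a] row[of a "\<lambda>_. 1"] that N adj_nonneg[of E "h a" u]
    by auto
  have end_le: "Y - (1 + r) * z a \<le> ?f (h a)" if "a = p \<or> a = p + 1" for a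
  proof -
    have "a < N" using that N by auto
    then show ?thesis
      using mult_right_mono[of 1 "real (deg E (h a)) - real p" "Y - (1 + r) * y (h a)"]
        deg_ge[OF that] non_neighbour_weight(1)[OF h_in(1)] by (simp add: z_def)
  qed
  have "h p \<noteq> h (p + 1)"
    using h N unfolding bij_betw_def inj_on_def by fastforce
  then have "?f u + ?f (h p) + ?f (h (p + 1)) = (\<Sum>w\<in>{u, h p, h (p + 1)}. ?f w)"
    using h_in[of p] h_in[of "p + 1"] N by auto
  also have "\<dots> \<le> (\<Sum>w=0..<n. ?f w)"
    using u(1) h_in N rich non_neighbour_weight
    by (intro sum_mono2) (auto intro!: mult_nonneg_nonneg)
  finally have "?f u + ?f (h p) + ?f (h (p + 1)) \<le> (\<Sum>w=0..<n. ?f w)" .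
  moreover have "?f u = - (Y - (1 + r) * y u)" using u(2) by simp
  ultimately show ?thesis
    using end_le[of p] end_le[of "p + 1"] main by (simp add: algebra_simps)
qed

section \<open>Isomorphism and induced subgraphs\<close>

lemma graph_iso_refl: "graph_iso n E E"
  unfolding graph_iso_def by (intro exI[of _ id]) auto

lemma graph_iso_sym:
  assumes "graph_iso n E H"
  shows "graph_iso n H E"
proof -
  obtain f where f: "bij_betw f {0..<n} {0..<n}"
    and fE: "\<And>u v. u < n \<Longrightarrow> v < n \<Longrightarrow> {u, v} \<in> E \<longleftrightarrow> {f u, f v} \<in> H"
    using assms unfolding graph_iso_def by auto
  let ?g = "inv_into {0..<n} f"
  have g: "bij_betw ?g {0..<n} {0..<n}" by (rule bij_betw_inv_into[OF f])
  have "{u, v} \<in> H \<longleftrightarrow> {?g u, ?g v} \<in> E" if "u < n" "v < n" for u v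
    using that fE[of "?g u" "?g v"] bij_betwE[OF g] bij_betw_inv_into_right[OF f] by simp
  then show ?thesis unfolding graph_iso_def using g by auto
qed

lemma eigenvalue_graph_iso:
  assumes "graph_iso n E H" "eigenvalue (adj_mat n H) k"
  shows "eigenvalue (adj_mat n E) k"
proof -
  obtain f where f: "bij_betw f {0..<n} {0..<n}"
    and fE: "\<And>u v. u < n \<Longrightarrow> v < n \<Longrightarrow> {u, v} \<in> E \<longleftrightarrow> {f u, f v} \<in> H"
    using assms(1) unfolding graph_iso_def by auto
  obtain y i where y: "eigenpair n H k y" "i < n" "y i \<noteq> 0"
    using assms(2) unfolding eigenvalue_adj_mat_iff by blast
  have "(\<Sum>u=0..<n. adj E v u * y (f u)) = k * y (f v)" if "v < n" for v
  proof -
    have "(\<Sum>u=0..<n. adj E v u * y (f u)) = (\<Sum>u=0..<n. adj H (f v) (f u) * y (f u))"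
      using that by (intro sum.cong) (auto simp: adj_def fE)
    also have "\<dots> = (\<Sum>w=0..<n. adj H (f v) w * y w)"
      by (rule sum.reindex_bij_betw[OF f])
    also have "\<dots> = k * y (f v)" using y(1) bij_betwE[OF f] that by (simp add: eigenpair_def)
    finally show ?thesis .
  qed
  then have "eigenpair n E k (\<lambda>v. y (f v))" by (simp add: eigenpair_def)
  moreover obtain j where "j < n" "f j = i"
    using f y(2) unfolding bij_betw_def by (metis atLeastLessThan_iff imageE zero_le)
  ultimately show ?thesis unfolding eigenvalue_adj_mat_iff using y(3) by blast
qed

lemma spec_rad_graph_iso:
  assumes "graph_iso n E H"
  shows "spec_rad n E = spec_rad n H"
proof -
  have "{k. eigenvalue (adj_mat n E) k} = {k. eigenvalue (adj_mat n H) k}"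
    using eigenvalue_graph_iso[OF assms] eigenvalue_graph_iso[OF graph_iso_sym[OF assms]] by blast
  then show ?thesis unfolding spec_rad_def by simp
qed

text \<open>Extremality speaks only of graphs on \<open>{0..<k}\<close>, so an induced subgraph has
  to be transported there. A copy of \<open>F\<close> in it would compose with \<open>g\<close> to a
  copy in \<open>E\<close>.\<close>

lemma induced_subgraph_relabel:
  assumes "graph_on n E" "F_free n E VF EF" "W \<subseteq> {0..<n}"
  obtains g E' where "bij_betw g {0..<card W} W" "graph_on (card W) E'" "F_free (card W) E' VF EF"
    "card E' = card {e \<in> E. e \<subseteq> W}"
    "\<And>a b. a < card W \<Longrightarrow> b < card W \<Longrightarrow> {a, b} \<in> E' \<longleftrightarrow> {g a, g b} \<in> E"
proof -
  have "finite W" using assms(3) finite_subset by blast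
  then obtain g where g: "bij_betw g {0..<card W} W" using ex_bij_betw_nat_finite by blast
  then have inj: "inj_on g {0..<card W}" and im: "g ` {0..<card W} = W"
    by (auto simp: bij_betw_def)
  define E' where "E' = {e. e \<subseteq> {0..<card W} \<and> g ` e \<in> E}"
  have graph': "graph_on (card W) E'"
    unfolding graph_on_def sgraph_def
  proof (intro conjI ballI)
    fix e assume e: "e \<in> E'"
    then have "card (g ` e) = 2" using assms(1) by (auto simp: E'_def graph_on_def sgraph_def)
    then show "card e = 2" using e inj by (metis (no_types, lifting) E'_def card_image inj_on_subset mem_Collect_eq)
  qed (auto simp: E'_def)
  have "bij_betw ((`) g) E' {e \<in> E. e \<subseteq> W}"
    unfolding bij_betw_def
  proof
    show "inj_on ((`) g) E'"
      using inj by (auto simp: inj_on_def[of "(`) g"] E'_def inj_on_image_eq_iff)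
    show "(`) g ` E' = {e \<in> E. e \<subseteq> W}"
      using im by (auto simp: E'_def image_iff elim!: subset_imageE) (metis subset_imageE)
  qed
  then have card': "card E' = card {e \<in> E. e \<subseteq> W}" by (rule bij_betw_same_card)
  have free': "F_free (card W) E' VF EF"
    unfolding F_free_def contains_def
  proof
    assume "\<exists>f. inj_on f VF \<and> f ` VF \<subseteq> {0..<card W} \<and> (\<forall>e\<in>EF. f ` e \<in> E')"
    then obtain f where f: "inj_on f VF" "f ` VF \<subseteq> {0..<card W}" "\<forall>e\<in>EF. f ` e \<in> E'" by blast
    have "inj_on (g \<circ> f) VF" using f inj by (meson comp_inj_on inj_on_subset)
    moreover have "(g \<circ> f) ` VF \<subseteq> {0..<n}" using f(2) im assms(3) by (auto simp: image_comp[symmetric])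
    moreover have "\<forall>e\<in>EF. (g \<circ> f) ` e \<in> E" using f(3) by (auto simp: E'_def image_comp)
    ultimately have "contains n E VF EF" unfolding contains_def by blast
    then show False using assms(2) by (simp add: F_free_def)
  qed
  show thesis by (rule that[OF g graph' free' card']) (auto simp: E'_def)
qed

section \<open>From edge extremality to spectral extremality\<close>

text \<open>Common frame for both statements: \<open>c\<close> is the number of edges beyond
  \<open>S_graph\<close>, so \<open>c = 0\<close> for \<open>S_graph\<close> and
  \<open>c = 1\<close> for \<open>S_plus\<close>.\<close>

locale extremal_family =
  fixes VF :: "'b set" and EF :: "'b set set" and H :: "nat \<Rightarrow> nat set set"
    and p M :: nat and c :: real
  assumes uniq: "\<And>k. M \<le> k \<Longrightarrow> unique_up_to_iso k (Ex k VF EF) (H k)"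
    and H_graph: "\<And>k. M \<le> k \<Longrightarrow> graph_on k (H k)"
    and H_card: "\<And>k. M \<le> k \<Longrightarrow> 2 * real (card (H k)) = 2 * real p * real k - real p * (real p + 1) + 2 * c"
    and c_le: "c \<le> 1" and p_M: "p + 2 \<le> M"
begin

lemma H_in_Ex: "M \<le> k \<Longrightarrow> H k \<in> Ex k VF EF"
  using uniq H_graph graph_iso_refl unfolding unique_up_to_iso_def by blast

lemma card_edges_le:
  assumes "M \<le> k" "graph_on k E" "F_free k E VF EF"
  shows "2 * real (card E) \<le> 2 * real p * real k - real p * (real p + 1) + 2 * c"
  using H_in_Ex[OF assms(1)] assms(2,3) unfolding H_card[OF assms(1), symmetric] Ex_def by auto

text \<open>By uniqueness and integrality a graph other than \<open>H k\<close> misses at least one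
  edge, hence 2 in the doubled bound.\<close>

lemma card_edges_le_not_iso:
  assumes "M \<le> k" "graph_on k E" "F_free k E VF EF" "\<not> graph_iso k E (H k)"
  shows "2 * real (card E) \<le> 2 * real p * real k - real p * (real p + 1) + 2 * c - 2"
proof -
  have "E \<notin> Ex k VF EF" using uniq[OF assms(1)] assms(2,4) unfolding unique_up_to_iso_def by blast
  moreover have "\<forall>E'. graph_on k E' \<and> F_free k E' VF EF \<longrightarrow> card E' \<le> card (H k)"
    using H_in_Ex[OF assms(1)] by (simp add: Ex_def)
  ultimately have "card E < card (H k)" using assms(2,3) unfolding Ex_def by fastforce
  then show ?thesis unfolding H_card[OF assms(1), symmetric] by linarith
qed

lemma card_induced_le:
  assumes "graph_on n E" "F_free n E VF EF" "W \<subseteq> {0..<n}" "M \<le> card W"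
  shows "2 * real (card {e \<in> E. e \<subseteq> W}) \<le> 2 * real p * real (card W) - real p * (real p + 1) + 2 * c"
proof -
  obtain E' where "graph_on (card W) E'" "F_free (card W) E' VF EF" "card E' = card {e \<in> E. e \<subseteq> W}"
    by (rule induced_subgraph_relabel[OF assms(1-3)])
  then show ?thesis using card_edges_le[OF assms(4)] by metis
qed

text \<open>Stability step for the tight case of \<open>S_plus\<close>: either an edge is lost or
  the induced subgraph is known exactly.\<close>

lemma card_induced_le_or_iso:
  assumes "graph_on n E" "F_free n E VF EF" "W \<subseteq> {0..<n}" "M \<le> card W"
  shows "2 * real (card {e \<in> E. e \<subseteq> W}) \<le> 2 * real p * real (card W) - real p * (real p + 1) + 2 * c - 2
    \<or> (\<exists>h. bij_betw h {0..<card W} W \<and>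
        (\<forall>a<card W. \<forall>b<card W. {h a, h b} \<in> E \<longleftrightarrow> {a, b} \<in> H (card W)))"
proof -
  obtain g E' where g: "bij_betw g {0..<card W} W" "graph_on (card W) E'" "F_free (card W) E' VF EF"
    "card E' = card {e \<in> E. e \<subseteq> W}"
    and gE: "\<And>a b. a < card W \<Longrightarrow> b < card W \<Longrightarrow> {a, b} \<in> E' \<longleftrightarrow> {g a, g b} \<in> E"
    by (rule induced_subgraph_relabel[OF assms(1-3)]) blast
  show ?thesis
  proof (cases "graph_iso (card W) E' (H (card W))")
    case False
    then show ?thesis using card_edges_le_not_iso[OF assms(4) g(2,3)] g(4) by simp
  next
    case True
    then obtain f where f: "bij_betw f {0..<card W} {0..<card W}"
      and fE: "\<And>u v. u < card W \<Longrightarrow> v < card W \<Longrightarrow> {u, v} \<in> H (card W) \<longleftrightarrow> {f u, f v} \<in> E'"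
      using graph_iso_sym[OF True] unfolding graph_iso_def by auto
    have "bij_betw (g \<circ> f) {0..<card W} W" by (rule bij_betw_trans[OF f g(1)])
    moreover have "{(g \<circ> f) a, (g \<circ> f) b} \<in> E \<longleftrightarrow> {a, b} \<in> H (card W)"
      if "a < card W" "b < card W" for a b
      using fE[OF that] gE[of "f a" "f b"] bij_betwE[OF f] that by simp
    ultimately show ?thesis by blast
  qed
qed

text \<open>Deleting all deficient vertices shows that the total deficiency lowers twice the edge
  number by double its amount, while the spectral bound gives it back only once.\<close>

lemma deficient_few:
  assumes "nonneg_eigenpair n E r y Y" "F_free n E VF EF" "card (deficient n E p) + M \<le> n"
  shows "r\<^sup>2 - (real p - 1) * r \<le> real p * (real n - real p) + 2 * c
    - (\<Sum>v\<in>deficient n E p. real p - real (deg E v))"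
proof -
  interpret nonneg_eigenpair n E r y Y by fact
  let ?D = "deficient n E p"
  have D: "?D \<subseteq> {0..<n}" "finite ?D" by (auto simp: deficient_def)
  have cW: "card ({0..<n} - ?D) = n - card ?D" using D by (simp add: card_Diff_subset)
  have "M \<le> card ({0..<n} - ?D)" using assms(3) cW by simp
  from card_induced_le[OF graph assms(2) _ this]
  have "2 * real (card {e \<in> E. e \<subseteq> {0..<n} - ?D})
      \<le> 2 * real p * (real n - real (card ?D)) - real p * (real p + 1) + 2 * c"
    using assms(3) cW by (simp add: of_nat_diff)
  moreover have "real (card E) \<le> real (card {e \<in> E. e \<subseteq> {0..<n} - ?D} + (\<Sum>v\<in>?D. deg E v))"
    using card_edges_le_remove[OF graph D(1)] of_nat_le_iff by blast
  moreover have "(\<Sum>v\<in>?D. real p - real (deg E v)) = real p * real (card ?D) - (\<Sum>v\<in>?D. real (deg E v))"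
    by (simp add: sum_subtractf)
  ultimately show ?thesis
    using Hong_Shu_Fang_deficient[of p] by (simp add: algebra_simps)
qed

text \<open>Exactly \<open>M\<close> vertices are kept. Kept deficient vertices cost at most
  \<open>M * p\<close> in all, while the \<open>n - M\<close> deleted ones gain at least 1 each;
  \<open>n >= M * (p + 3)\<close> makes the gain exceed the cost plus \<open>2 * c\<close>.\<close>

lemma deficient_many:
  assumes "nonneg_eigenpair n E r y Y" "F_free n E VF EF" "card (deficient n E p) + M > n"
    and big: "M * (p + 3) \<le> n"
  shows "r\<^sup>2 - (real p - 1) * r < real p * (real n - real p)"
proof -
  interpret nonneg_eigenpair n E r y Y by fact
  let ?D = "deficient n E p"
  let ?d = "\<lambda>v. real p - real (deg E v)"
  have "M \<le> M * (p + 3)" by simp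
  then have Mn: "M \<le> n" using big by (rule order_trans)
  have D: "?D \<subseteq> {0..<n}" "finite ?D" by (auto simp: deficient_def)
  have cD: "card ?D \<le> n" using card_mono[OF _ D(1)] by simp
  obtain D' where D': "D' \<subseteq> ?D" "card D' = n - M" "finite D'"
  proof (rule obtain_subset_with_card_n)
    show "n - M \<le> card ?D" using assms(3) by simp
  qed
  have D'n: "D' \<subseteq> {0..<n}" using D D' by blast
  have cW: "card ({0..<n} - D') = M" using D' D'n Mn by (simp add: card_Diff_subset)
  have "2 * real (card {e \<in> E. e \<subseteq> {0..<n} - D'}) \<le> 2 * real p * real M - real p * (real p + 1) + 2 * c"
    using card_induced_le[OF graph assms(2), of "{0..<n} - D'"] cW by simp
  moreover have "real (card E) \<le> real (card {e \<in> E. e \<subseteq> {0..<n} - D'} + (\<Sum>v\<in>D'. deg E v))"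
    using card_edges_le_remove[OF graph D'n] of_nat_le_iff by blast
  moreover have "(\<Sum>v\<in>D'. ?d v) = real p * (real n - real M) - (\<Sum>v\<in>D'. real (deg E v))"
    using D' Mn by (simp add: sum_subtractf of_nat_diff)
  ultimately have e: "2 * real (card E) \<le> 2 * real p * real n - real p * (real p + 1) + 2 * c - 2 * (\<Sum>v\<in>D'. ?d v)"
    by (simp add: algebra_simps)
  have split: "(\<Sum>v\<in>?D. ?d v) = (\<Sum>v\<in>?D - D'. ?d v) + (\<Sum>v\<in>D'. ?d v)"
    by (rule sum.subset_diff[OF D'(1) D(2)])
  have "card (?D - D') \<le> M"
    using D' cD Mn by (simp add: card_Diff_subset)
  moreover have "(\<Sum>v\<in>?D - D'. ?d v) \<le> real (card (?D - D')) * real p"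
    by (rule sum_bounded_above) simp
  ultimately have small: "(\<Sum>v\<in>?D - D'. ?d v) \<le> real M * real p"
    by (meson mult_right_mono of_nat_0_le_iff of_nat_mono order_trans)
  have "real (card D') * 1 \<le> (\<Sum>v\<in>D'. ?d v)"
    using D'(1) by (intro sum_bounded_below) (force simp: deficient_def)
  then have large: "real n - real M \<le> (\<Sum>v\<in>D'. ?d v)" using D'(2) Mn by (simp add: of_nat_diff)
  have "real (M * (p + 3)) \<le> real n" using big of_nat_le_iff by blast
  then have "real M * real p + 3 * real M \<le> real n" by (simp add: algebra_simps)
  moreover have "real M \<ge> 2" using p_M by simp
  ultimately show ?thesis
    using Hong_Shu_Fang_deficient[of p] e split small large c_le by (simp add: algebra_simps)
qed

lemma card_le_sum_deficiency:
  "real (card (deficient n E p)) \<le> (\<Sum>v\<in>deficient n E p. real p - real (deg E v))"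
proof -
  have "real (card (deficient n E p)) * 1 \<le> (\<Sum>v\<in>deficient n E p. real p - real (deg E v))"
    by (rule sum_bounded_below) (force simp: deficient_def)
  then show ?thesis by simp
qed

text \<open>The term \<open>2 * c - 2\<close> is negative for \<open>S_graph\<close> and zero for
  \<open>S_plus\<close>, which is as much as each case requires.\<close>

lemma no_deficient_not_iso:
  assumes "nonneg_eigenpair n E r y Y" "F_free n E VF EF" "\<not> graph_iso n E (H n)" "M \<le> n"
    and "deficient n E p = {}"
  shows "r\<^sup>2 - (real p - 1) * r \<le> real p * (real n - real p) + 2 * c - 2"
proof -
  interpret nonneg_eigenpair n E r y Y by fact
  show ?thesis
    using Hong_Shu_Fang_deficient[of p] card_edges_le_not_iso[OF assms(4) graph assms(2,3)] assms(5)
    by (simp add: algebra_simps)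
qed

text \<open>Reduces the claim to a strict comparison with each \<open>F\<close>-free graph not
  isomorphic to \<open>H n\<close>; isomorphic ones share its spectral radius.\<close>

lemma unique_spectral_extremal:
  assumes "M \<le> n"
    and less: "\<And>E. graph_on n E \<Longrightarrow> F_free n E VF EF \<Longrightarrow> \<not> graph_iso n E (H n) \<Longrightarrow>
      spec_rad n E < spec_rad n (H n)"
  shows "unique_up_to_iso n (Ex_sp n VF EF) (H n)"
  unfolding unique_up_to_iso_def
proof (intro allI impI iffI)
  fix E assume E: "graph_on n E" "E \<in> Ex_sp n VF EF"
  have "F_free n (H n) VF EF" using H_in_Ex[OF assms(1)] by (simp add: Ex_def)
  then have "spec_rad n (H n) \<le> spec_rad n E"
    using E(2) H_graph[OF assms(1)] by (simp add: Ex_sp_def)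
  then show "graph_iso n E (H n)" using less[OF E(1)] E(2) by (force simp: Ex_sp_def)
next
  fix E assume E: "graph_on n E" "graph_iso n E (H n)"
  \<comment> \<open>\<open>F\<close>-freeness of an isomorphic copy is read off from its membership
    in \<open>Ex\<close>.\<close>
  then have "E \<in> Ex n VF EF" using uniq[OF assms(1)] by (simp add: unique_up_to_iso_def)
  then have "F_free n E VF EF" by (simp add: Ex_def)
  moreover have "spec_rad n E' \<le> spec_rad n E" if "graph_on n E'" "F_free n E' VF EF" for E'
    using less[OF that] spec_rad_graph_iso[of n E' "H n"] spec_rad_graph_iso[OF E(2)] by force
  ultimately show "E \<in> Ex_sp n VF EF" using E(1) by (simp add: Ex_sp_def)
qed

end

section \<open>Existence of eigenpairs and numerical estimates for large \<open>n\<close>\<close>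

lemma (in nonneg_eigenpair) eigenvalue_nonneg: "0 \<le> r"
proof -
  have "0 \<le> r * Y"
    unfolding sum_deg_weighted[symmetric] using nonneg by (intro sum_nonneg mult_nonneg_nonneg) auto
  then show ?thesis using Y_pos by (simp add: zero_le_mult_iff)
qed

lemma spec_rad_nonneg_eigenpair:
  assumes "graph_on n E" "n > 0"
  obtains y Y where "nonneg_eigenpair n E (spec_rad n E) y Y"
  by (metis spec_rad_Perron[OF assms(2)] nonneg_eigenpair.intro assms(1))

text \<open>The quadratic forces \<open>r\<close> to be of order \<open>sqrt (p * n)\<close>, well
  inside the range required in the tight case of \<open>S_plus\<close>.\<close>

lemma quadratic_window:
  fixes r p n :: real
  assumes "2 \<le> p" "64 * p\<^sup>2 \<le> n" "0 \<le> r"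
    and "p * (n - p) < r\<^sup>2 - (p - 1) * r" "r\<^sup>2 - (p - 1) * r \<le> p * (n - p) + 2"
  shows "3 \<le> r" "2 * r \<le> n - p - 3"
proof -
  have "p * 2 \<le> p * p" using assms(1) by (intro mult_left_mono) auto
  then have pn: "128 * p \<le> n" using assms(2) by (simp add: power2_eq_square)
  have "2 * 126 \<le> p * (n - p)" using assms(1) pn by (intro mult_mono) auto
  then have "9 < r\<^sup>2 - (p - 1) * r" using assms(4) by simp
  moreover have "0 \<le> (p - 1) * r" using assms by simp
  ultimately have "3\<^sup>2 < r\<^sup>2" by simp
  then show "3 \<le> r" using assms(3) by (meson less_imp_le power2_less_imp_less)
  show "2 * r \<le> n - p - 3"
  proof (rule ccontr)
    assume "\<not> ?thesis"
    \<comment> \<open>A larger \<open>r\<close> would make the quadratic at least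
      \<open>n^2 / 12\<close>, whereas it is at most \<open>p * n\<close>, hence at most
      \<open>n^2 / 128\<close>.\<close>
    then have "n / 3 \<le> r" "n / 4 \<le> r - (p - 1)" using pn assms(1) by auto
    then have "n / 3 * (n / 4) \<le> r * (r - (p - 1))"
      using pn assms(1) by (intro mult_mono) auto
    also have "\<dots> \<le> p * (n - p) + 2" using assms(5) by (simp add: power2_eq_square algebra_simps)
    also have "\<dots> \<le> p * n" using assms(1) \<open>p * 2 \<le> p * p\<close> by (simp only: right_diff_distrib)
    also have "\<dots> \<le> n / 128 * n" using pn assms(1) by (intro mult_right_mono) auto
    finally have "n * n \<le> 0" by simp
    moreover have "0 < n * n" using pn assms(1) by (intro mult_pos_pos) auto
    ultimately show False by simp
  qed
qed

text \<open>Equality holds at \<open>p = 2\<close>; each step multiplies the left side by at most 4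
  and the right side by 16.\<close>

lemma power_bound:
  assumes "2 \<le> p"
  shows "64 * p\<^sup>2 \<le> 2 ^ (4 * p)"
  using assms
proof (induction p rule: dec_induct)
  case (step k)
  have "(Suc k)\<^sup>2 \<le> (2 * k)\<^sup>2" using step.hyps by (intro power_mono) auto
  then show ?case using step.IH by (simp add: power2_eq_square power_add)
qed simp

text \<open>If \<open>m\<close> is at least \<open>p + 3\<close>, the product is at most
  \<open>m^2\<close>; otherwise it is at most \<open>(p + 3)^2\<close>, which the exponential bound
  covers.\<close>

lemma threshold:
  assumes "2 \<le> p" "2 ^ (4 * p) \<le> n" "m\<^sup>2 \<le> n"
  shows "max m (p + 2) * (p + 3) \<le> n" "max m (p + 2) \<le> n"
proof -
  have "(p + 3)\<^sup>2 \<le> (8 * p)\<^sup>2" using assms(1) by (intro power_mono) auto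
  also have "\<dots> \<le> n" using power_bound[OF assms(1)] assms(2) by (simp add: power_mult_distrib)
  finally have p3: "(p + 3) * (p + 3) \<le> n" by (simp add: power2_eq_square)
  show 1: "max m (p + 2) * (p + 3) \<le> n"
  proof (cases "p + 3 \<le> m")
    case True
    then have "m * (p + 3) \<le> m * m" by (intro mult_le_mono2)
    also have "\<dots> \<le> n" using assms(3) by (simp add: power2_eq_square)
    finally show ?thesis using True by simp
  next
    case False
    then have "max m (p + 2) * (p + 3) \<le> (p + 3) * (p + 3)" by (intro mult_le_mono1) auto
    then show ?thesis using p3 by (rule order_trans)
  qed
  have "x \<le> x * (p + 3)" for x by simp
  then show "max m (p + 2) \<le> n" using 1 by (rule order_trans)
qed

section \<open>The two extremal families\<close>

text \<open>Here \<open>c = 0\<close>: every competitor falls strictly below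
  \<open>S_root n p\<close>, an eigenvalue of \<open>S_graph n p\<close>.\<close>

lemma spectral_extremal_S_graph:
  assumes p: "2 \<le> p" and n: "2 ^ (4 * p) \<le> n" "m\<^sup>2 \<le> n"
    and uniq: "\<And>k. m \<le> k \<Longrightarrow> unique_up_to_iso k (Ex k VF EF) (S_graph k p)"
  shows "unique_up_to_iso n (Ex_sp n VF EF) (S_graph n p)"
proof -
  define M where "M = max m (p + 2)"
  have M: "M * (p + 3) \<le> n" "M \<le> n" using threshold[OF p n] by (auto simp: M_def)
  have pn: "0 < p" "p < n" "p \<le> n" "0 < n" using p M by (auto simp: M_def)
  interpret extremal_family VF EF "\<lambda>k. S_graph k p" p M 0
  proof
    fix k assume k: "M \<le> k"
    then show "unique_up_to_iso k (Ex k VF EF) (S_graph k p)" using uniq by (simp add: M_def)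
    have "real (2 * card (S_graph k p) + p * (p + 1)) = real (2 * p * k)"
      using card_S_graph[of p k] k by (simp add: M_def)
    then show "2 * real (card (S_graph k p)) = 2 * real p * real k - real p * (real p + 1) + 2 * 0"
      by (simp add: algebra_simps)
  qed (auto simp: M_def graph_on_S_graph)
  show ?thesis
  proof (rule unique_spectral_extremal[OF M(2)])
    fix E assume E: "graph_on n E" "F_free n E VF EF" "\<not> graph_iso n E (S_graph n p)"
    let ?r = "spec_rad n E"
    obtain y Y where ep: "nonneg_eigenpair n E ?r y Y"
      using spec_rad_nonneg_eigenpair[OF E(1) pn(4)] .
    have "?r\<^sup>2 - (real p - 1) * ?r < real p * (real n - real p)"
    proof (cases "card (deficient n E p) + M \<le> n")
      case False
      then show ?thesis using deficient_many[OF ep E(2) _ M(1)] by simp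
    next
      case few: True
      show ?thesis
      proof (cases "deficient n E p = {}")
        case True
        then show ?thesis using no_deficient_not_iso[OF ep E(2,3) M(2)] by simp
      next
        case False
        then have "0 < card (deficient n E p)" by (simp add: card_gt_0_iff deficient_def)
        then show ?thesis using deficient_few[OF ep E(2) few] card_le_sum_deficiency[of n E] by simp
      qed
    qed
    then have "?r < S_root n p" by (rule less_S_root[OF pn(1,3)])
    also have "\<dots> \<le> spec_rad n (S_graph n p)" by (rule spec_rad_S_graph_ge[OF pn(1,2)])
    finally show "?r < spec_rad n (S_graph n p)" .
  qed
qed

text \<open>Here \<open>c = 1\<close>: competitors need only be at most \<open>S_root n p\<close>,
  because \<open>S_plus n p\<close> strictly exceeds it.\<close>

lemma spectral_extremal_S_plus:
  assumes p: "2 \<le> p" and n: "2 ^ (4 * p) \<le> n" "m\<^sup>2 \<le> n"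
    and uniq: "\<And>k. m \<le> k \<Longrightarrow> unique_up_to_iso k (Ex k VF EF) (S_plus k p)"
  shows "unique_up_to_iso n (Ex_sp n VF EF) (S_plus n p)"
proof -
  \<comment> \<open>The bound \<open>p + 2\<close> keeps the extra edge \<open>{p, p + 1}\<close>
    inside the vertex set.\<close>
  define M where "M = max m (p + 2)"
  have M: "M * (p + 3) \<le> n" "M \<le> n" using threshold[OF p n] by (auto simp: M_def)
  have pn: "0 < p" "p + 2 \<le> n" "p \<le> n" "0 < n" using p M by (auto simp: M_def)
  interpret extremal_family VF EF "\<lambda>k. S_plus k p" p M 1
  proof
    fix k assume k: "M \<le> k"
    then show "unique_up_to_iso k (Ex k VF EF) (S_plus k p)" using uniq by (simp add: M_def)
    have "real (2 * card (S_graph k p) + p * (p + 1)) = real (2 * p * k)"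
      using card_S_graph[of p k] k by (simp add: M_def)
    then show "2 * real (card (S_plus k p)) = 2 * real p * real k - real p * (real p + 1) + 2 * 1"
      by (simp add: card_S_plus algebra_simps)
    show "graph_on k (S_plus k p)" using k by (simp add: M_def graph_on_S_plus)
  qed (auto simp: M_def)
  show ?thesis
  proof (rule unique_spectral_extremal[OF M(2)])
    fix E assume E: "graph_on n E" "F_free n E VF EF" "\<not> graph_iso n E (S_plus n p)"
    let ?r = "spec_rad n E"
    let ?D = "deficient n E p"
    let ?X = "real p * (real n - real p)"
    obtain y Y where ep: "nonneg_eigenpair n E ?r y Y"
      using spec_rad_nonneg_eigenpair[OF E(1) pn(4)] .
    interpret nonneg_eigenpair n E ?r y Y by (rule ep)
    have "?r\<^sup>2 - (real p - 1) * ?r \<le> ?X"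
    proof (cases "card ?D + M \<le> n")
      case False
      then show ?thesis using deficient_many[OF ep E(2) _ M(1)] by simp
    next
      case few: True
      note few_le = deficient_few[OF ep E(2) few]
      show ?thesis
      proof (cases "?D = {} \<or> 2 \<le> (\<Sum>v\<in>?D. real p - real (deg E v))")
        case True
        then show ?thesis using no_deficient_not_iso[OF ep E(2,3) M(2)] few_le by auto
      next
        case False
        \<comment> \<open>Each deficient vertex contributes at least 1, so a total below 2 leaves a
          single vertex, of degree \<open>p - 1\<close>.\<close>
        then have "card ?D > 0" "real (card ?D) < 2"
          using card_le_sum_deficiency[of n E] by (auto simp: card_gt_0_iff deficient_def)
        then have "card ?D = 1" by linarith
        then obtain u where u: "?D = {u}" by (auto simp: card_1_singleton_iff)
        then have un: "u < n" "deg E u < p" by (auto simp: deficient_def)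
        have "\<not> deg E u + 2 \<le> p" using False unfolding u by auto
        then have "deg E u + 1 = p" using un(2) by linarith
        then have du: "real (deg E u) = real p - 1" by linarith
        have rich: "p \<le> deg E v" if "v < n" "v \<noteq> u" for v
        proof (rule ccontr)
          assume "\<not> p \<le> deg E v"
          then have "v \<in> ?D" using that by (simp add: deficient_def)
          then show False using u that by simp
        qed
        let ?W = "{0..<n} - {u}"
        have cW: "card ?W = n - 1" using un by simp
        have Mn: "M \<le> n - 1" using few u by simp
        have nr: "real (n - 1) = real n - 1" using pn by (simp add: of_nat_diff)
        have "card E \<le> card {e \<in> E. e \<subseteq> ?W} + deg E u"
          using card_edges_le_remove[OF graph, of "{u}"] un by simp
        then have "real (card E) \<le> real (card {e \<in> E. e \<subseteq> ?W}) + real (deg E u)"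
          by (metis of_nat_add of_nat_mono)
        then have e: "2 * real (card E) \<le> 2 * real (card {e \<in> E. e \<subseteq> ?W}) + 2 * (real p - 1)"
          using du by simp
        have D_sum: "(\<Sum>v\<in>?D. real p - real (deg E v)) = 1" using u du by simp
        from card_induced_le_or_iso[OF graph E(2), of ?W] Mn cW
        consider "2 * real (card {e \<in> E. e \<subseteq> ?W}) \<le> 2 * real p * (real n - 1) - real p * (real p + 1)"
          | h where "bij_betw h {0..<n - 1} ?W"
            "\<And>a b. a < n - 1 \<Longrightarrow> b < n - 1 \<Longrightarrow> {h a, h b} \<in> E \<longleftrightarrow> {a, b} \<in> S_plus (n - 1) p"
          unfolding cW nr by force
        then show ?thesis
        proof cases
          case 1
          then show ?thesis using e D_sum Hong_Shu_Fang_deficient[of p] by (simp add: algebra_simps)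
        next
          case (2 h)
          show ?thesis
          \<comment> \<open>The excess sum is nonnegative by the configuration, yet the assumption
            puts it strictly below \<open>Y\<close> times a quantity that the edge count shows to be
            at most 0.\<close>
          proof (rule ccontr)
            assume "\<not> ?thesis"
            then have gt: "?X < ?r\<^sup>2 - (real p - 1) * ?r" by simp
            have "64 * p\<^sup>2 \<le> n" using power_bound[OF p] n(1) by simp
            then have "real (64 * p\<^sup>2) \<le> real n" using of_nat_le_iff by blast
            then have "64 * (real p)\<^sup>2 \<le> real n" by simp
            note r = quadratic_window[OF _ this eigenvalue_nonneg gt]
            have "3 \<le> ?r" "2 * ?r \<le> real n - real p - 3"
              using r p few_le D_sum by simp_all
            then have "0 \<le> (\<Sum>w=0..<n. (real (deg E w) - real p) * (Y - (1 + ?r) * y w))"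
              using excess_nonneg_S_plus_extension[OF un(1) du rich 2] Mn by (simp add: M_def)
            also have "\<dots> < Y * (2 * real (card E) - real p * (real n - 1) - ?X)"
              by (rule excess_le[OF gt])
            finally have "0 < 2 * real (card E) - real p * (real n - 1) - ?X"
              using Y_pos by (simp add: zero_less_mult_iff)
            moreover have "2 * real (card {e \<in> E. e \<subseteq> ?W})
                \<le> 2 * real p * (real n - 1) - real p * (real p + 1) + 2"
              using card_induced_le[OF graph E(2), of ?W] Mn cW nr by simp
            ultimately show False using e by (simp add: algebra_simps)
          qed
        qed
      qed
    qed
    then have "?r \<le> S_root n p" by (rule le_S_root[OF pn(1,3)])
    also have "\<dots> < spec_rad n (S_plus n p)" by (rule spec_rad_S_plus_greater[OF pn(1,2)])
    finally show "?r < spec_rad n (S_plus n p)" .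
  qed
qed

theorem theorem1p7:
  fixes VF :: "'b set" and EF :: "'b set set" and p m :: nat
  assumes "sgraph VF EF" and "p \<ge> 2" and "m > 0"
  shows "((\<forall>n\<ge>m. unique_up_to_iso n (Ex n VF EF) (S_graph n p)) \<longrightarrow>
           (\<forall>n. n \<ge> 2 ^ (4 * p) \<and> n \<ge> m ^ 2 \<longrightarrow>
                unique_up_to_iso n (Ex_sp n VF EF) (S_graph n p)))
       \<and> ((\<forall>n\<ge>m. unique_up_to_iso n (Ex n VF EF) (S_plus n p)) \<longrightarrow>
           (\<forall>n. n \<ge> 2 ^ (4 * p) \<and> n \<ge> m ^ 2 \<longrightarrow>
                unique_up_to_iso n (Ex_sp n VF EF) (S_plus n p)))"
  using spectral_extremal_S_graph[OF assms(2)] spectral_extremal_S_plus[OF assms(2)] by blast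

end
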